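(* Let $n\ge 1$, let $d_1,\dots,d_n\ge 1$ be integers, and let $\mathbf d=(d_1,\dots,d_n)$. For every $f\in\mathcal H_{\mathbf d}$ with $f\neq 0$, $$\tilde\kappa(f)=\frac{\|f\|_W}{\operatorname{dist}(f,\Sigma_{\mathbb R})},$$ where both sides are understood in $(0,\infty]$ (with the convention $1/0=\infty$).
   Context: For $d\ge 1$, $\mathcal H_d$ is the real vector space of homogeneous polynomials of degree $d$ in $\mathbb R[x_0,\dots,x_n]$, endowed with the Bombieri-Weyl inner product: for $f=\sum_{|j|=d}a_j x^j$ and $g=\sum_{|j|=d}b_jx^j$, $\langle f,g\rangle_W=\sum_{|j|=d}a_jb_j/\binom{d}{j}$, where $\binom{d}{j}=\frac{d!}{j_0!\cdots j_n!}$ for $j=(j_0,\dots,j_n)$. Put $\mathcal H_{\mathbf d}=\mathcal H_{d_1}\times\cdots\times\mathcal H_{d_n}$ with inner product $\langle f,g\rangle_W=\sum_{i=1}^n\langle f_i,g_i\rangle_W$ for $f=(f_1,\dots,f_n)$, $g=(g_1,\dots,g_n)$; $\|\cdot\|_W$ and $\operatorname{dist}$ are the induced norm and distance on $\mathcal H_{\mathbf d}$ (distance to a set being the infimum of distances to its elements). Elements $f\in\mathcal H_{\mathbf d}$ are viewed as maps from the unit sphere $S^n\subset\mathbb R^{n+1}$ to $\mathbb R^n$. For $x\in S^n$, $T_xS^n=x^\perp$ is the tangent space, and $Df(x)_{|T_xS^n}:T_xS^n\to\mathbb R^n$ is the restriction of the derivative of $f$ at $x$. A point $x\in S^n$ is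 a multiple zero of $f$ if $f(x)=0$ and $Df(x)_{|T_xS^n}$ is singular (not invertible). $\Sigma_{\mathbb R}=\{f\in\mathcal H_{\mathbf d}\mid f\text{ has a multiple zero in }S^n\}$. For $f\ne 0$ and $x\in S^n$, $$\tilde\mu_{\rm norm}(f,x)=\|f\|_W\,\big\|Df(x)_{|T_xS^n}^{-1}\,\operatorname{diag}(\sqrt{d_1},\dots,\sqrt{d_n})\big\|,$$ with the spectral (Euclidean operator) norm, and $\tilde\mu_{\rm norm}(f,x)=\infty$ (so $\tilde\mu_{\rm norm}(f,x)^{-2}=0$) if $Df(x)_{|T_xS^n}$ is singular. The condition of $f$ relative to $x$ is $$\tilde\kappa(f,x)=\frac{\|f\|_W}{\big(\|f\|_W^2\,\tilde\mu_{\rm norm}(f,x)^{-2}+\|f(x)\|_2^2\big)^{1/2}}\in(0,\infty]$$ (equal to $\infty$ if the denominator is $0$), and $\tilde\kappa(f)=\max_{x\in S^n}\tilde\kappa(f,x)$. *)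

theory Defs
  imports "HOL-Analysis.Analysis" "HOL-Library.Poly_Mapping"
begin

text \<open>
  A type \<open>'n\<close> of class \<open>finite\<close> with \<open>CARD('n) = n \<ge> 1\<close> indexes the \<open>n\<close> equations.  The
  \<open>n + 1\<close> variables are indexed by \<open>'n option\<close>, with \<open>None\<close> as the index of \<open>x\<^sub>0\<close>; accordingly
  \<open>real ^ 'n option\<close> is the space of dimension \<open>n + 1\<close>.  A polynomial is a finitely supported
  map from exponents to coefficients.
\<close>

type_synonym 'v exponent = "'v \<Rightarrow>\<^sub>0 nat"
type_synonym 'v mpoly = "'v exponent \<Rightarrow>\<^sub>0 real"
type_synonym 'n polysys = "('n option mpoly) ^ 'n"

definition total_degree :: "'v::finite exponent \<Rightarrow> nat" where
  "total_degree j = (\<Sum>k\<in>UNIV. Poly_Mapping.lookup j k)"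

definition multinomial :: "'v::finite exponent \<Rightarrow> real" where
  "multinomial j = fact (total_degree j) / (\<Prod>k\<in>UNIV. fact (Poly_Mapping.lookup j k))"

definition mpoly_eval :: "'v::finite mpoly \<Rightarrow> real ^ 'v \<Rightarrow> real" where
  "mpoly_eval p x =
    (\<Sum>j\<in>Poly_Mapping.keys p. Poly_Mapping.lookup p j * (\<Prod>k\<in>UNIV. (x $ k) ^ Poly_Mapping.lookup j k))"

definition homogeneous :: "nat \<Rightarrow> 'v::finite mpoly set" where
  "homogeneous d = {p. \<forall>j\<in>Poly_Mapping.keys p. total_degree j = d}"

definition bw_inner_poly :: "nat \<Rightarrow> 'v::finite mpoly \<Rightarrow> 'v mpoly \<Rightarrow> real" where
  "bw_inner_poly d p q =
    (\<Sum>j | total_degree j = d. Poly_Mapping.lookup p j * Poly_Mapping.lookup q j / multinomial j)"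

text \<open>The index set of the sum above is finite, so that sum is not vacuously zero.\<close>

lemma finite_exponents_of_degree: "finite {j :: 'v::finite exponent. total_degree j = d}"
proof (rule finite_imageD)
  let ?A = "{j :: 'v exponent. total_degree j = d}"
  have "Poly_Mapping.lookup j k \<le> total_degree j" for j :: "'v exponent" and k
    unfolding total_degree_def by (rule member_le_sum) simp_all
  then have sub: "Poly_Mapping.lookup ` ?A \<subseteq> (\<Pi>\<^sub>E k\<in>UNIV. {..d})"
    by (force simp: PiE_iff)
  have "finite (\<Pi>\<^sub>E k\<in>(UNIV :: 'v set). {..d})"
    by (rule finite_PiE) simp_all
  with sub show "finite (Poly_Mapping.lookup ` ?A)"
    by (rule finite_subset)
  show "inj_on Poly_Mapping.lookup ?A"
    by (rule inj_onI) simp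
qed

definition homogeneous_systems :: "('n::finite \<Rightarrow> nat) \<Rightarrow> 'n polysys set" where
  "homogeneous_systems d = {f. \<forall>i. f $ i \<in> homogeneous (d i)}"

definition bw_inner :: "('n::finite \<Rightarrow> nat) \<Rightarrow> 'n polysys \<Rightarrow> 'n polysys \<Rightarrow> real" where
  "bw_inner d f g = (\<Sum>i\<in>UNIV. bw_inner_poly (d i) (f $ i) (g $ i))"

definition bw_norm :: "('n::finite \<Rightarrow> nat) \<Rightarrow> 'n polysys \<Rightarrow> real" where
  "bw_norm d f = sqrt (bw_inner d f f)"

definition bw_setdist :: "('n::finite \<Rightarrow> nat) \<Rightarrow> 'n polysys \<Rightarrow> 'n polysys set \<Rightarrow> ennreal" where
  "bw_setdist d f A = (INF g\<in>A. ennreal (bw_norm d (f - g)))"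

definition sys_eval :: "'n::finite polysys \<Rightarrow> real ^ 'n option \<Rightarrow> real ^ 'n" where
  "sys_eval f x = (\<chi> i. mpoly_eval (f $ i) x)"

abbreviation tangent_space :: "real ^ 'n::finite option \<Rightarrow> (real ^ 'n option) set" where
  "tangent_space x \<equiv> {x}\<^sup>\<bottom>"

abbreviation sys_deriv :: "'n::finite polysys \<Rightarrow> real ^ 'n option \<Rightarrow> real ^ 'n option \<Rightarrow> real ^ 'n" where
  "sys_deriv f x \<equiv> frechet_derivative (sys_eval f) (at x)"

definition tangent_singular :: "'n::finite polysys \<Rightarrow> real ^ 'n option \<Rightarrow> bool" where
  "tangent_singular f x \<longleftrightarrow> \<not> bij_betw (sys_deriv f x) (tangent_space x) UNIV"

definition multiple_zero :: "'n::finite polysys \<Rightarrow> real ^ 'n option \<Rightarrow> bool" where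
  "multiple_zero f x \<longleftrightarrow> sys_eval f x = 0 \<and> tangent_singular f x"

definition discriminant_variety :: "('n::finite \<Rightarrow> nat) \<Rightarrow> 'n polysys set" where
  "discriminant_variety d = {f \<in> homogeneous_systems d. \<exists>x\<in>sphere 0 1. multiple_zero f x}"

definition mu_norm :: "('n::finite \<Rightarrow> nat) \<Rightarrow> 'n polysys \<Rightarrow> real ^ 'n option \<Rightarrow> ennreal" where
  "mu_norm d f x =
    (if tangent_singular f x then \<infinity>
     else ennreal (bw_norm d f *
       onorm (\<lambda>y :: real ^ 'n. inv_into (tangent_space x) (sys_deriv f x)
                                 (\<chi> i. sqrt (real (d i)) * y $ i))))"

text \<open>
  In \<open>ennreal\<close>, \<open>1 / \<infinity> = 0\<close>, and \<open>a / 0 = \<infinity>\<close> for \<open>a \<noteq> 0\<close>.  For \<open>f \<noteq> 0\<close> and all \<open>d i \<ge> 1\<close>,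
  \<open>mu_norm d f x\<close> is nonzero, so \<open>1 / (mu_norm d f x)\<^sup>2\<close> is finite and \<open>enn2real\<close> does not
  truncate it.
\<close>

definition kappa_at :: "('n::finite \<Rightarrow> nat) \<Rightarrow> 'n polysys \<Rightarrow> real ^ 'n option \<Rightarrow> ennreal" where
  "kappa_at d f x =
    ennreal (bw_norm d f) /
    ennreal (sqrt ((bw_norm d f)\<^sup>2 * enn2real (1 / (mu_norm d f x)\<^sup>2) + (norm (sys_eval f x))\<^sup>2))"

text \<open>The theorem also asserts that this supremum is attained, i.e. that it is a maximum.\<close>

definition kappa :: "('n::finite \<Rightarrow> nat) \<Rightarrow> 'n polysys \<Rightarrow> ennreal" where
  "kappa d f = (SUP x\<in>sphere 0 1. kappa_at d f x)"

end

theory Submission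
  imports Defs
begin

text \<open>
  For a fixed unit vector \<open>x\<close>, a system has a multiple zero at \<open>x\<close> iff its value at \<open>x\<close> and its
  derivative at \<open>x\<close> along some unit tangent vector \<open>w\<close> vanish.  For fixed \<open>(x, w)\<close> these are linear
  conditions represented, in the Bombieri--Weyl product, by orthogonal reproducing polynomials of squared
  norms \<open>1\<close> and \<open>d\<^sub>i\<close>; so the squared distance of \<open>f\<close> to that linear subspace is
  \<open>\<Sum>\<^sub>i f\<^sub>i(x)\<^sup>2 + (D\<^sub>w f\<^sub>i(x))\<^sup>2 / d\<^sub>i\<close>.  Minimising over \<open>w\<close> turns the second part into the square of the
  smallest singular value of \<open>diag(1/\<surd>d\<^sub>i) Df(x)\<close> on the tangent space, which is the inverse of the
  operator norm in the condition number.  Minimising over \<open>x\<close> as well gives the theorem, and the minimum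
  exists because the unit tangent bundle is compact.
\<close>

section \<open>Monomials, their directional derivatives and multinomial identities\<close>

definition monomial_eval :: "'v::finite exponent \<Rightarrow> real ^ 'v \<Rightarrow> real" where
  "monomial_eval j x = (\<Prod>k\<in>UNIV. (x $ k) ^ Poly_Mapping.lookup j k)"

text \<open>The directional derivative along \<open>w\<close>, in the shape produced by the product
  rule. The truncated exponent \<open>lookup j k - 1\<close> is harmless at 0, where the factor
  \<open>lookup j k\<close> vanishes.\<close>

definition monomial_deriv :: "'v::finite exponent \<Rightarrow> real ^ 'v \<Rightarrow> real ^ 'v \<Rightarrow> real" where
  "monomial_deriv j x w =
    (\<Sum>k\<in>UNIV. real (Poly_Mapping.lookup j k) * w $ k * (x $ k) ^ (Poly_Mapping.lookup j k - 1) *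
      (\<Prod>l\<in>UNIV - {k}. (x $ l) ^ Poly_Mapping.lookup j l))"

lemma has_derivative_monomial_eval:
  "(monomial_eval j has_derivative monomial_deriv j x) (at x)"
  unfolding monomial_eval_def [abs_def] monomial_deriv_def [abs_def]
  by (rule has_derivative_prod) (auto intro!: derivative_eq_intros bounded_linear_imp_has_derivative)

lemma multinomial_pos: "multinomial j > 0"
  unfolding multinomial_def by (auto intro!: divide_pos_pos prod_pos)

lemma multinomial_theorem:
  fixes z :: "real ^ 'v::finite"
  shows "(\<Sum>j | total_degree j = d. multinomial j * monomial_eval j z) = (\<Sum>k\<in>UNIV. z $ k) ^ d"
proof -
  text \<open>Induction on the degree: multiply by \<open>d + 1 = \<Sum>\<^sub>k j\<^sub>k\<close> and substitute \<open>j = j' + e\<^sub>k\<close>.\<close>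
  define t where "t j = (\<Prod>k\<in>UNIV. (z $ k) ^ Poly_Mapping.lookup j k / fact (Poly_Mapping.lookup j k))"
    for j :: "'v exponent"
  have t_add: "real (Poly_Mapping.lookup (j + Poly_Mapping.single k 1) k) *
      t (j + Poly_Mapping.single k 1) = z $ k * t j"
    for j k
  proof -
    have rest: "(\<Prod>l\<in>UNIV - {k}. (z $ l) ^ Poly_Mapping.lookup (j + Poly_Mapping.single k 1) l /
          fact (Poly_Mapping.lookup (j + Poly_Mapping.single k 1) l)) =
        (\<Prod>l\<in>UNIV - {k}. (z $ l) ^ Poly_Mapping.lookup j l / fact (Poly_Mapping.lookup j l))"
      by (rule prod.cong) (auto simp: lookup_add lookup_single)
    show ?thesis
      unfolding t_def
      by (subst (1 2) prod.remove [where x = k]) (auto simp: rest lookup_add lookup_single field_simps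
          simp del: of_nat_Suc)
  qed
  have deg_add: "total_degree (j + Poly_Mapping.single k 1) = Suc (total_degree j)" for j :: "'v exponent" and k
    by (simp add: total_degree_def lookup_add sum.distrib lookup_single when_def)
  have shift: "(\<Sum>j | total_degree j = d. z $ k * t j) =
      (\<Sum>j | total_degree j = Suc d. real (Poly_Mapping.lookup j k) * t j)" for d k
  \<comment> \<open>Adding \<open>single k 1\<close> reaches exactly the exponents with a positive
    entry at \<open>k\<close>. The others form \<open>T'\<close>: they have no preimage, but their
    terms are zero.\<close>
  proof (rule sum.reindex_bij_witness_not_neutral [where S' = "{}"
        and T' = "{j. total_degree j = Suc d \<and> Poly_Mapping.lookup j k = 0}"
        and j = "\<lambda>j. j + Poly_Mapping.single k 1" and i = "\<lambda>j. j - Poly_Mapping.single k 1"])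
    fix j :: "'v exponent"
    assume "j \<in> {j. total_degree j = Suc d} - {j. total_degree j = Suc d \<and> Poly_Mapping.lookup j k = 0}"
    then have j: "total_degree j = Suc d" "Poly_Mapping.lookup j k > 0" by auto
    show inv: "j - Poly_Mapping.single k 1 + Poly_Mapping.single k 1 = j"
      using j by (auto intro!: poly_mapping_eqI simp: lookup_add lookup_minus lookup_single when_def)
    show "j - Poly_Mapping.single k 1 \<in> {j. total_degree j = d} - {}"
      using deg_add [of "j - Poly_Mapping.single k 1" k] j unfolding inv by simp
  next
    show "finite {j. total_degree j = Suc d \<and> Poly_Mapping.lookup j k = 0}"
      by (rule finite_subset [OF _ finite_exponents_of_degree [of "Suc d"]]) auto
  qed (use deg_add [of _ k] t_add [of _ k] in \<open>simp_all add: lookup_add\<close>)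
  have "(\<Sum>j | total_degree j = d. t j) = (\<Sum>k\<in>UNIV. z $ k) ^ d / fact d"
  proof (induction d)
    case 0
    have "total_degree j = 0 \<longleftrightarrow> j = 0" for j :: "'v exponent"
      by (auto simp: total_degree_def intro!: poly_mapping_eqI)
    then show ?case by (simp add: t_def)
  next
    case (Suc d)
    have "real (Suc d) * (\<Sum>j | total_degree j = Suc d. t j) =
        (\<Sum>j | total_degree j = Suc d. \<Sum>k\<in>UNIV. real (Poly_Mapping.lookup j k) * t j)"
      unfolding sum_distrib_left
      by (rule sum.cong) (auto simp: total_degree_def simp flip: sum_distrib_right of_nat_sum)
    also have "\<dots> = (\<Sum>k\<in>UNIV. \<Sum>j | total_degree j = Suc d. real (Poly_Mapping.lookup j k) * t j)"
      by (rule sum.swap)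
    also have "\<dots> = (\<Sum>k\<in>UNIV. z $ k) * ((\<Sum>k\<in>UNIV. z $ k) ^ d / fact d)"
      by (simp only: shift [symmetric] Suc.IH sum_distrib_left [symmetric] sum_distrib_right [symmetric])
    finally show ?case
      by (simp add: field_simps del: of_nat_Suc)
  qed
  moreover have "(\<Sum>j | total_degree j = d. multinomial j * monomial_eval j z) =
      fact d * (\<Sum>j | total_degree j = d. t j)"
    unfolding sum_distrib_left
    by (rule sum.cong) (auto simp: t_def multinomial_def monomial_eval_def prod_dividef)
  ultimately show ?thesis by simp
qed

text \<open>The multinomial theorem at the componentwise product of \<open>x\<close> and
  \<open>y\<close>. The result is the reproducing kernel of the Bombieri-Weyl product.\<close>

lemma sum_monomial_eval_eval:
  fixes x y :: "real ^ 'v::finite"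
  shows "(\<Sum>j | total_degree j = d. multinomial j * monomial_eval j x * monomial_eval j y) = (x \<bullet> y) ^ d"
  using multinomial_theorem [of "\<chi> k. x $ k * y $ k" d]
  by (simp add: monomial_eval_def inner_vec_def power_mult_distrib prod.distrib mult.assoc)

text \<open>Differentiate the kernel identity in \<open>y\<close>; both sides are derivatives of the
  same function, so they agree by uniqueness.\<close>

lemma sum_monomial_eval_deriv:
  fixes x y w :: "real ^ 'v::finite"
  shows "(\<Sum>j | total_degree j = d. multinomial j * monomial_eval j x * monomial_deriv j y w) =
    real d * (x \<bullet> w) * (x \<bullet> y) ^ (d - 1)"
proof -
  have "((\<lambda>y. \<Sum>j | total_degree j = d. multinomial j * monomial_eval j x * monomial_eval j y) has_derivative
      (\<lambda>w. \<Sum>j | total_degree j = d. multinomial j * monomial_eval j x * monomial_deriv j y w)) (at y)"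
    by (intro has_derivative_sum has_derivative_mult_right has_derivative_monomial_eval)
  moreover have "((\<lambda>y. (x \<bullet> y) ^ d) has_derivative (\<lambda>w. real d * (x \<bullet> w) * (x \<bullet> y) ^ (d - 1))) (at y)"
    by (auto intro!: derivative_eq_intros)
  ultimately show ?thesis
    unfolding sum_monomial_eval_eval by (rule has_derivative_unique [THEN fun_cong])
qed

text \<open>The previous identity, differentiated once more, now in \<open>x\<close> along
  \<open>v\<close>.\<close>

lemma sum_monomial_deriv_deriv:
  fixes x y v w :: "real ^ 'v::finite"
  shows "(\<Sum>j | total_degree j = d. multinomial j * monomial_deriv j x v * monomial_deriv j y w) =
    real d * ((x \<bullet> w) * (real (d - 1) * (v \<bullet> y) * (x \<bullet> y) ^ (d - 1 - 1)) + (v \<bullet> w) * (x \<bullet> y) ^ (d - 1))"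
proof -
  have "((\<lambda>x. \<Sum>j | total_degree j = d. multinomial j * monomial_eval j x * monomial_deriv j y w) has_derivative
      (\<lambda>v. \<Sum>j | total_degree j = d. multinomial j * monomial_deriv j x v * monomial_deriv j y w)) (at x)"
    by (intro has_derivative_sum has_derivative_mult_right has_derivative_mult_left has_derivative_monomial_eval)
  moreover have "((\<lambda>x. real d * (x \<bullet> w) * (x \<bullet> y) ^ (d - 1)) has_derivative
      (\<lambda>v. real d * ((x \<bullet> w) * (real (d - 1) * (v \<bullet> y) * (x \<bullet> y) ^ (d - 1 - 1)) + (v \<bullet> w) * (x \<bullet> y) ^ (d - 1)))) (at x)"
    by (auto intro!: derivative_eq_intros simp: algebra_simps)
  ultimately show ?thesis
    unfolding sum_monomial_eval_deriv by (rule has_derivative_unique [THEN fun_cong])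
qed

section \<open>Homogeneous polynomials and the Bombieri-Weyl form\<close>

definition mpoly_deriv :: "'v::finite mpoly \<Rightarrow> real ^ 'v \<Rightarrow> real ^ 'v \<Rightarrow> real" where
  "mpoly_deriv p x w =
    (\<Sum>j\<in>Poly_Mapping.keys p. Poly_Mapping.lookup p j * monomial_deriv j x w)"

lemma mpoly_eval_eq:
  "mpoly_eval p x = (\<Sum>j\<in>Poly_Mapping.keys p. Poly_Mapping.lookup p j * monomial_eval j x)"
  by (simp add: mpoly_eval_def monomial_eval_def)

lemma has_derivative_mpoly_eval: "(mpoly_eval p has_derivative mpoly_deriv p x) (at x)"
  unfolding mpoly_eval_eq [abs_def] mpoly_deriv_def [abs_def]
  by (intro has_derivative_sum has_derivative_mult_right has_derivative_monomial_eval)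

text \<open>Summing over all exponents of degree \<open>d\<close> instead of the keys gives every
  polynomial the same index set, which makes linearity in the coefficients immediate.\<close>

lemma
  assumes "p \<in> homogeneous d"
  shows homogeneous_eval: "mpoly_eval p x =
      (\<Sum>j | total_degree j = d. Poly_Mapping.lookup p j * monomial_eval j x)"
    and homogeneous_deriv: "mpoly_deriv p x w =
      (\<Sum>j | total_degree j = d. Poly_Mapping.lookup p j * monomial_deriv j x w)"
proof -
  have "Poly_Mapping.keys p \<subseteq> {j. total_degree j = d}"
    using assms by (auto simp: homogeneous_def)
  then show "mpoly_eval p x = (\<Sum>j | total_degree j = d. Poly_Mapping.lookup p j * monomial_eval j x)"
    and "mpoly_deriv p x w = (\<Sum>j | total_degree j = d. Poly_Mapping.lookup p j * monomial_deriv j x w)"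
    unfolding mpoly_eval_eq mpoly_deriv_def
    by (auto intro!: sum.mono_neutral_left finite_exponents_of_degree simp: in_keys_iff)
qed

lemma homogeneous_iff: "p \<in> homogeneous d \<longleftrightarrow> (\<forall>j. Poly_Mapping.lookup p j \<noteq> 0 \<longrightarrow> total_degree j = d)"
  by (auto simp: homogeneous_def in_keys_iff)

lemma homogeneous_diff: "p \<in> homogeneous d \<Longrightarrow> q \<in> homogeneous d \<Longrightarrow> p - q \<in> homogeneous d"
  by (auto simp: homogeneous_iff lookup_minus) (metis diff_zero)

lemma mpoly_eval_diff:
  "p \<in> homogeneous d \<Longrightarrow> q \<in> homogeneous d \<Longrightarrow> mpoly_eval (p - q) x = mpoly_eval p x - mpoly_eval q x"
  by (simp add: homogeneous_eval [of _ d] homogeneous_diff lookup_minus algebra_simps sum_subtractf)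

lemma mpoly_deriv_diff:
  "p \<in> homogeneous d \<Longrightarrow> q \<in> homogeneous d \<Longrightarrow> mpoly_deriv (p - q) x w = mpoly_deriv p x w - mpoly_deriv q x w"
  by (simp add: homogeneous_deriv [of _ d] homogeneous_diff lookup_minus algebra_simps sum_subtractf)

lemma bw_inner_poly_nonneg: "0 \<le> bw_inner_poly d p p"
  unfolding bw_inner_poly_def by (auto intro!: sum_nonneg divide_nonneg_pos multinomial_pos)

lemma bw_inner_poly_eq_0:
  assumes "p \<in> homogeneous d" "bw_inner_poly d p p = 0"
  shows "p = 0"
proof (rule poly_mapping_eqI)
  fix j
  have "\<forall>j\<in>{j. total_degree j = d}. Poly_Mapping.lookup p j * Poly_Mapping.lookup p j / multinomial j = 0"
    using assms(2) unfolding bw_inner_poly_def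
    by (subst (asm) sum_nonneg_eq_0_iff)
      (auto intro!: divide_nonneg_pos multinomial_pos finite_exponents_of_degree)
  then have "Poly_Mapping.lookup p j = 0" if "total_degree j = d"
    using that multinomial_pos [of j] by force
  with assms(1) show "Poly_Mapping.lookup p j = Poly_Mapping.lookup 0 j"
    by (auto simp: homogeneous_iff)
qed

section \<open>Reproducing polynomials for values and directional derivatives\<close>

definition kernel_poly :: "nat \<Rightarrow> real ^ 'v::finite \<Rightarrow> real ^ 'v \<Rightarrow> real \<Rightarrow> real \<Rightarrow> 'v mpoly" where
  "kernel_poly d x w a b = Poly_Mapping.Abs_poly_mapping (\<lambda>j. if total_degree j = d
    then multinomial j * (a * monomial_eval j x + b * monomial_deriv j x w) else 0)"

lemma lookup_kernel_poly:
  "Poly_Mapping.lookup (kernel_poly d x w a b) j =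
    (if total_degree j = d then multinomial j * (a * monomial_eval j x + b * monomial_deriv j x w) else 0)"
  unfolding kernel_poly_def
  by (subst lookup_Abs_poly_mapping) (auto intro: finite_subset [OF _ finite_exponents_of_degree [of d]])

lemma kernel_poly_homogeneous: "kernel_poly d x w a b \<in> homogeneous d"
  by (auto simp: homogeneous_iff lookup_kernel_poly)

text \<open>The reproducing property: the multinomial factors in the coefficients of
  \<open>kernel_poly\<close> cancel the weights of the inner product.\<close>

lemma bw_inner_kernel_poly:
  assumes "p \<in> homogeneous d"
  shows "bw_inner_poly d p (kernel_poly d x w a b) = a * mpoly_eval p x + b * mpoly_deriv p x w"
proof -
  have nz: "multinomial j \<noteq> 0" for j :: "'a exponent"
    using multinomial_pos [of j] by simp
  show ?thesis
    unfolding bw_inner_poly_def homogeneous_eval [OF assms] homogeneous_deriv [OF assms]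
      sum_distrib_left sum.distrib [symmetric]
    by (rule sum.cong) (auto simp: lookup_kernel_poly nz field_simps)
qed

lemma bw_inner_poly_diff_self:
  "bw_inner_poly d (p - q) (p - q) = bw_inner_poly d p p - 2 * bw_inner_poly d p q + bw_inner_poly d q q"
  by (simp add: bw_inner_poly_def lookup_minus algebra_simps add_divide_distrib diff_divide_distrib
      sum.distrib sum_subtractf sum_distrib_left)

text \<open>For orthonormal \<open>x\<close> and \<open>w\<close> the kernel sums at
  \<open>x = y\<close>, \<open>v = w\<close> collapse to 1, 0 and \<open>d\<close>: the two
  representers are orthogonal, with squared norms 1 and \<open>d\<close>.\<close>

lemma
  fixes x w :: "real ^ 'v::finite"
  assumes "norm x = 1" "norm w = 1" "x \<bullet> w = 0"
  shows kernel_poly_eval: "mpoly_eval (kernel_poly d x w a b) x = a"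
    and kernel_poly_deriv: "mpoly_deriv (kernel_poly d x w a b) x w = b * real d"
proof -
  have [simp]: "x \<bullet> x = 1" "w \<bullet> w = 1"
    using assms by (simp_all add: norm_eq_1)
  have "mpoly_eval (kernel_poly d x w a b) x =
      a * (\<Sum>j | total_degree j = d. multinomial j * monomial_eval j x * monomial_eval j x)
      + b * (\<Sum>j | total_degree j = d. multinomial j * monomial_eval j x * monomial_deriv j x w)"
    unfolding homogeneous_eval [OF kernel_poly_homogeneous] sum_distrib_left sum.distrib [symmetric]
    by (rule sum.cong) (auto simp: lookup_kernel_poly algebra_simps)
  then show "mpoly_eval (kernel_poly d x w a b) x = a"
    by (simp add: sum_monomial_eval_eval sum_monomial_eval_deriv assms)
  have "mpoly_deriv (kernel_poly d x w a b) x w =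
      a * (\<Sum>j | total_degree j = d. multinomial j * monomial_eval j x * monomial_deriv j x w)
      + b * (\<Sum>j | total_degree j = d. multinomial j * monomial_deriv j x w * monomial_deriv j x w)"
    unfolding homogeneous_deriv [OF kernel_poly_homogeneous] sum_distrib_left sum.distrib [symmetric]
    by (rule sum.cong) (auto simp: lookup_kernel_poly algebra_simps)
  then show "mpoly_deriv (kernel_poly d x w a b) x w = b * real d"
    by (simp add: sum_monomial_deriv_deriv sum_monomial_eval_deriv assms)
qed

text \<open>The reproducing property applied to the kernel polynomial itself.\<close>

lemma bw_inner_poly_kernel_self:
  assumes "norm x = 1" "norm w = 1" "x \<bullet> w = 0"
  shows "bw_inner_poly d (kernel_poly d x w a b) (kernel_poly d x w a b) = a\<^sup>2 + b\<^sup>2 * real d"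
  by (simp add: bw_inner_kernel_poly kernel_poly_homogeneous kernel_poly_eval kernel_poly_deriv assms
      power2_eq_square)

text \<open>Bessel's inequality for the two representers: the kernel polynomial with coefficients
  \<open>p(x)\<close> and \<open>D_w p(x) / d\<close> is the orthogonal projection of
  \<open>p\<close> onto their span, and the residual has nonnegative squared norm.\<close>

lemma bw_inner_poly_ge:
  assumes "norm x = 1" "norm w = 1" "x \<bullet> w = 0" "p \<in> homogeneous d" "d \<ge> 1"
  shows "(mpoly_eval p x)\<^sup>2 + (mpoly_deriv p x w)\<^sup>2 / real d \<le> bw_inner_poly d p p"
proof -
  have "0 \<le> bw_inner_poly d (p - kernel_poly d x w (mpoly_eval p x) (mpoly_deriv p x w / real d))
      (p - kernel_poly d x w (mpoly_eval p x) (mpoly_deriv p x w / real d))"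
    by (rule bw_inner_poly_nonneg)
  moreover have "(mpoly_deriv p x w / real d)\<^sup>2 * real d = (mpoly_deriv p x w)\<^sup>2 / real d"
    using assms(5) by (simp add: power2_eq_square)
  ultimately show ?thesis
    using assms(1-4)
    by (simp add: bw_inner_poly_diff_self bw_inner_kernel_poly bw_inner_poly_kernel_self power2_eq_square)
qed

section \<open>Tangent derivatives, their singularity and the defect\<close>

lemma mem_tangent_space: "w \<in> tangent_space x \<longleftrightarrow> x \<bullet> w = 0"
  by (simp add: orthogonal_comp_def orthogonal_def)

lemma has_derivative_sys_eval:
  fixes f :: "'n::finite polysys"
  shows "(sys_eval f has_derivative (\<lambda>w. \<chi> i. mpoly_deriv (f $ i) x w)) (at x)"
proof -
  have "\<exists>i. b = axis i 1" if "b \<in> Basis" for b :: "real ^ 'n"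
    using that by (auto simp: Basis_vec_def)
  then show ?thesis
    unfolding has_derivative_componentwise_within [where f = "sys_eval f"] sys_eval_def
    by (force simp: inner_axis intro: has_derivative_mpoly_eval)
qed

lemma sys_deriv_eq: "sys_deriv f x = (\<lambda>w. \<chi> i. mpoly_deriv (f $ i) x w)"
  by (rule frechet_derivative_at [OF has_derivative_sys_eval, symmetric])

lemma linear_sys_deriv: "linear (sys_deriv f x)"
  unfolding sys_deriv_eq
  by (rule bounded_linear.linear [OF has_derivative_bounded_linear [OF has_derivative_sys_eval]])

text \<open>The hyperplane orthogonal to \<open>x\<close> has dimension \<open>CARD('n)\<close>,
  that of the target, so bijectivity reduces to injectivity; a nonzero kernel vector can be
  normalised.\<close>

lemma tangent_singular_iff:
  fixes x :: "real ^ 'n::finite option"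
  assumes "x \<noteq> 0"
  shows "tangent_singular f x \<longleftrightarrow> (\<exists>w. norm w = 1 \<and> x \<bullet> w = 0 \<and> sys_deriv f x w = 0)"
proof
  interpret D: linear "sys_deriv f x"
    by (rule linear_sys_deriv)
  have sub: "subspace (tangent_space x)"
    by (rule subspace_orthogonal_comp)
  show "\<exists>w. norm w = 1 \<and> x \<bullet> w = 0 \<and> sys_deriv f x w = 0" if "tangent_singular f x"
  proof (rule ccontr)
    assume no: "\<nexists>w. norm w = 1 \<and> x \<bullet> w = 0 \<and> sys_deriv f x w = 0"
    have inj: "inj_on (sys_deriv f x) (tangent_space x)"
    proof (subst linear_inj_on_iff_eq_0 [OF linear_sys_deriv sub], intro ballI impI)
      fix w assume w: "w \<in> tangent_space x" "sys_deriv f x w = 0"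
      show "w = 0"
      proof (rule ccontr)
        assume "w \<noteq> 0"
        with w have "norm (w /\<^sub>R norm w) = 1 \<and> x \<bullet> (w /\<^sub>R norm w) = 0 \<and> sys_deriv f x (w /\<^sub>R norm w) = 0"
          by (simp add: mem_tangent_space D.scale)
        with no show False by blast
      qed
    qed
    have "dim (sys_deriv f x ` tangent_space x) = dim (tangent_space x)"
      using inj by (intro dim_image_eq linear_sys_deriv) (simp add: span_eq_iff [THEN iffD2, OF sub])
    also have "\<dots> = dim {w. x \<bullet> w = 0}"
      by (rule arg_cong [of _ _ dim]) (auto simp: mem_tangent_space)
    also have "\<dots> = CARD('n)"
      by (simp add: dim_hyperplane assms)
    finally have "sys_deriv f x ` tangent_space x = UNIV"
      by (intro subspace_dim_equal linear_subspace_image linear_sys_deriv sub subspace_UNIV) simp_all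
    with inj that show False
      by (simp add: tangent_singular_def bij_betw_def)
  qed
  show "tangent_singular f x" if "\<exists>w. norm w = 1 \<and> x \<bullet> w = 0 \<and> sys_deriv f x w = 0"
    using that
    by (auto simp: tangent_singular_def bij_betw_def mem_tangent_space
        linear_inj_on_iff_eq_0 [OF linear_sys_deriv sub])
qed

text \<open>On the tangent space this is the inverse of the map whose operator norm enters
  \<open>mu_norm\<close>, whenever that inverse exists.\<close>

definition scaled_deriv ::
    "('n::finite \<Rightarrow> nat) \<Rightarrow> 'n polysys \<Rightarrow> real ^ 'n option \<Rightarrow> real ^ 'n option \<Rightarrow> real ^ 'n" where
  "scaled_deriv d f x w = (\<chi> i. sys_deriv f x w $ i / sqrt (real (d i)))"

lemma linear_scaled_deriv: "linear (scaled_deriv d f x)"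
proof -
  interpret D: linear "sys_deriv f x"
    by (rule linear_sys_deriv)
  show ?thesis
    by (rule linearI) (simp_all add: scaled_deriv_def vec_eq_iff D.add D.scale add_divide_distrib)
qed

text \<open>For orthonormal \<open>x\<close>, \<open>w\<close> and all \<open>d i\<close> positive:
  the squared distance of a homogeneous system \<open>f\<close> to those vanishing at
  \<open>x\<close> together with their derivative along \<open>w\<close>.\<close>

definition defect :: "('n::finite \<Rightarrow> nat) \<Rightarrow> 'n polysys \<Rightarrow> real ^ 'n option \<Rightarrow> real ^ 'n option \<Rightarrow> real" where
  "defect d f x w = (norm (sys_eval f x))\<^sup>2 + (norm (scaled_deriv d f x w))\<^sup>2"

lemma norm_vec_power2: "(norm (y :: real ^ 'n::finite))\<^sup>2 = (\<Sum>i\<in>UNIV. (y $ i)\<^sup>2)"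
  by (simp add: norm_vec_def L2_set_def sum_nonneg)

lemma defect_eq:
  "defect d f x w = (\<Sum>i\<in>UNIV. (mpoly_eval (f $ i) x)\<^sup>2 + (mpoly_deriv (f $ i) x w)\<^sup>2 / real (d i))"
  by (simp add: defect_def norm_vec_power2 sys_eval_def scaled_deriv_def sys_deriv_eq power_divide
      sum.distrib)

section \<open>Bombieri-Weyl distance to systems with a multiple zero\<close>

lemma bw_inner_self_nonneg: "0 \<le> bw_inner d f f"
  by (simp add: bw_inner_def sum_nonneg bw_inner_poly_nonneg)

lemma bw_norm_pos:
  assumes "f \<in> homogeneous_systems d" "f \<noteq> 0"
  shows "bw_norm d f > 0"
proof -
  have "bw_inner d f f \<noteq> 0"
  proof
    assume "bw_inner d f f = 0"
    then have "\<forall>i. bw_inner_poly (d i) (f $ i) (f $ i) = 0"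
      by (simp add: bw_inner_def sum_nonneg_eq_0_iff bw_inner_poly_nonneg)
    with assms(1) have "\<forall>i. f $ i = 0"
      by (auto simp: homogeneous_systems_def intro: bw_inner_poly_eq_0)
    with assms(2) show False
      by (simp add: vec_eq_iff)
  qed
  with bw_inner_self_nonneg [of d f] show ?thesis
    by (simp add: bw_norm_def)
qed

text \<open>Take \<open>w\<close> in the kernel of the tangent derivative of \<open>g\<close>. Then
  \<open>f - g\<close> has the same values at \<open>x\<close> and derivatives along
  \<open>w\<close> as \<open>f\<close>, and Bessel's inequality applies in each equation.\<close>

lemma bw_norm_diff_multiple_zero_ge:
  assumes d: "\<And>i. d i \<ge> 1" and f: "f \<in> homogeneous_systems d" and g: "g \<in> homogeneous_systems d"
    and x: "norm x = 1" and "multiple_zero g x"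
  shows "\<exists>w. norm w = 1 \<and> x \<bullet> w = 0 \<and> sqrt (defect d f x w) \<le> bw_norm d (f - g)"
proof -
  have "x \<noteq> 0" using x by auto
  with assms(5) obtain w where w: "norm w = 1" "x \<bullet> w = 0" "sys_deriv g x w = 0" and z: "sys_eval g x = 0"
    by (auto simp: multiple_zero_def tangent_singular_iff)
  have fg: "f $ i \<in> homogeneous (d i)" "g $ i \<in> homogeneous (d i)" for i
    using f g by (auto simp: homogeneous_systems_def)
  have g0: "mpoly_eval (g $ i) x = 0" "mpoly_deriv (g $ i) x w = 0" for i
    using w(3) z by (simp_all add: sys_deriv_eq sys_eval_def vec_eq_iff)
  have "defect d f x w \<le> bw_inner d (f - g) (f - g)"
    unfolding defect_eq bw_inner_def
  proof (rule sum_mono)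
    fix i
    show "(mpoly_eval (f $ i) x)\<^sup>2 + (mpoly_deriv (f $ i) x w)\<^sup>2 / real (d i)
        \<le> bw_inner_poly (d i) ((f - g) $ i) ((f - g) $ i)"
      using bw_inner_poly_ge [OF x w(1,2) homogeneous_diff [OF fg [of i]] d [of i]]
      by (simp add: mpoly_eval_diff [OF fg] mpoly_deriv_diff [OF fg] g0)
  qed
  with w show ?thesis
    by (auto simp: bw_norm_def)
qed

text \<open>The lower bound is attained by removing from \<open>f\<close> its projection onto the
  span of the representers.\<close>

lemma ex_multiple_zero_at_defect:
  assumes d: "\<And>i. d i \<ge> 1" and f: "f \<in> homogeneous_systems d"
    and xw: "norm x = 1" "norm w = 1" "x \<bullet> w = 0"
  shows "\<exists>g\<in>discriminant_variety d. bw_norm d (f - g) = sqrt (defect d f x w)"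
proof -
  \<comment> \<open>The division by \<open>d i\<close> compensates the squared norm
    \<open>d i\<close> of the derivative representer, so \<open>r\<close> has the values of
    \<open>f\<close> at \<open>x\<close> and its derivatives along \<open>w\<close>.\<close>
  define r where "r = (\<chi> i. kernel_poly (d i) x w (mpoly_eval (f $ i) x) (mpoly_deriv (f $ i) x w / real (d i)))"
  have r: "r $ i \<in> homogeneous (d i)" for i
    by (simp add: r_def kernel_poly_homogeneous)
  have fi: "f $ i \<in> homogeneous (d i)" for i
    using f by (auto simp: homogeneous_systems_def)
  have d0: "d i \<noteq> 0" for i
    using d [of i] by simp
  have g0: "mpoly_eval ((f - r) $ i) x = 0" "mpoly_deriv ((f - r) $ i) x w = 0" for i
    using xw by (simp_all add: mpoly_eval_diff [OF fi r] mpoly_deriv_diff [OF fi r])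
      (simp_all add: r_def kernel_poly_eval kernel_poly_deriv d0)
  have "f - r \<in> homogeneous_systems d"
    by (simp add: homogeneous_systems_def homogeneous_diff fi r)
  moreover have "multiple_zero (f - r) x"
    unfolding multiple_zero_def
  proof
    show "sys_eval (f - r) x = 0"
      using g0 by (simp add: sys_eval_def vec_eq_iff)
    have "x \<noteq> 0" using xw by auto
    moreover have "sys_deriv (f - r) x w = 0"
      using g0 by (simp add: sys_deriv_eq vec_eq_iff)
    ultimately show "tangent_singular (f - r) x"
      using xw by (auto simp: tangent_singular_iff)
  qed
  ultimately have "f - r \<in> discriminant_variety d"
    using xw by (auto simp: discriminant_variety_def)
  moreover have "bw_inner d r r = defect d f x w"
    unfolding bw_inner_def defect_eq
    by (rule sum.cong)
      (auto simp: r_def bw_inner_poly_kernel_self xw d0 power_divide power2_eq_square)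
  then have "bw_norm d (f - (f - r)) = sqrt (defect d f x w)"
    by (simp add: bw_norm_def)
  ultimately show ?thesis by blast
qed

section \<open>The condition number at a point\<close>

text \<open>The smallest singular value is the reciprocal of the norm of the inverse. Evaluating
  \<open>L\<close> at \<open>S w\<close> bounds \<open>onorm L\<close> from below; minimality of
  \<open>w\<close>, extended by homogeneity, bounds it from above.\<close>

lemma inverse_onorm_eq_minimum:
  fixes S :: "'a::euclidean_space \<Rightarrow> 'b::euclidean_space" and L :: "'b \<Rightarrow> 'a"
  assumes S: "linear S" and L: "linear L"
    and T: "subspace T" and w: "w \<in> T" "norm w = 1"
    and min: "\<And>v. v \<in> T \<Longrightarrow> norm v = 1 \<Longrightarrow> norm (S w) \<le> norm (S v)"
    and range: "\<And>y. L y \<in> T" and SL: "\<And>y. S (L y) = y" and LS: "\<And>v. v \<in> T \<Longrightarrow> L (S v) = v"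
  shows "onorm L > 0" "norm (S w) = 1 / onorm L"
proof -
  interpret S: linear S by (rule S)
  interpret L: linear L by (rule L)
  have bl: "bounded_linear L"
    using L by (simp add: linear_conv_bounded_linear)
  \<comment> \<open>The vector \<open>L (S w) = w\<close> has norm 1.\<close>
  have "1 \<le> onorm L * norm (S w)"
    using onorm [OF bl, of "S w"] w LS by simp
  then have pos: "norm (S w) > 0"
    using onorm_pos_le [OF bl] by (metis mult_zero_right norm_ge_zero not_one_le_zero order_le_less)
  have lower: "norm (S w) * norm v \<le> norm (S v)" if "v \<in> T" for v
  proof (cases "v = 0")
    case False
    then have "norm (S w) \<le> norm (S (v /\<^sub>R norm v))"
      using that by (intro min subspace_scale [OF T]) auto
    with False show ?thesis
      by (simp add: S.scale field_simps)
  qed simp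
  have "onorm L \<le> 1 / norm (S w)"
  proof (rule onorm_bound)
    show "norm (L y) \<le> 1 / norm (S w) * norm y" for y
      using lower [OF range [of y]] pos by (simp add: SL field_simps)
  qed simp
  then have "onorm L * norm (S w) \<le> 1"
    using pos by (simp add: field_simps)
  with \<open>1 \<le> onorm L * norm (S w)\<close> have eq: "onorm L * norm (S w) = 1"
    by simp
  then have "onorm L \<noteq> 0"
    by auto
  with eq onorm_pos_le [OF bl] show "onorm L > 0" "norm (S w) = 1 / onorm L"
    by (simp_all add: field_simps)
qed

text \<open>Once the \<open>mu_norm\<close> term is identified with the squared minimum of the
  scaled derivative, the denominator is the root of the minimal defect at \<open>x\<close>.\<close>

lemma kappa_at_eq:
  fixes d :: "'n::finite \<Rightarrow> nat"
  assumes d: "\<And>i. d i \<ge> 1" and f: "f \<in> homogeneous_systems d" "f \<noteq> 0"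
    and x: "norm x = 1" and w: "norm w = 1" "x \<bullet> w = 0"
    and min: "\<And>v. norm v = 1 \<Longrightarrow> x \<bullet> v = 0 \<Longrightarrow> defect d f x w \<le> defect d f x v"
  shows "kappa_at d f x = ennreal (bw_norm d f) / ennreal (sqrt (defect d f x w))"
proof -
  let ?N = "bw_norm d f" and ?S = "scaled_deriv d f x" and ?D = "sys_deriv f x"
  have x0: "x \<noteq> 0" using x by auto
  have N: "?N > 0" using f by (rule bw_norm_pos)
  have d0: "d i \<noteq> 0" for i
    using d [of i] by simp
  \<comment> \<open>The value part of the defect does not depend on the direction, so
    \<open>w\<close> also minimises the derivative part.\<close>
  have min': "norm (?S w) \<le> norm (?S v)" if "v \<in> tangent_space x" "norm v = 1" for v
    using min [OF that(2)] that(1) by (simp add: defect_def mem_tangent_space)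
  \<comment> \<open>In the singular case both sides are 0: \<open>mu_norm\<close> is infinite, and a
    kernel vector forces the minimum to vanish.\<close>
  have "?N\<^sup>2 * enn2real (1 / (mu_norm d f x)\<^sup>2) = (norm (?S w))\<^sup>2"
  proof (cases "tangent_singular f x")
    case True
    then obtain v where v: "norm v = 1" "x \<bullet> v = 0" "?D v = 0"
      using tangent_singular_iff [OF x0] by blast
    then have "norm (?S w) \<le> 0"
      using min' [of v] by (simp add: mem_tangent_space scaled_deriv_def zero_vec_def [symmetric])
    with True show ?thesis
      by (simp add: mu_norm_def power2_eq_square)
  next
    case False
    let ?L = "\<lambda>y. inv_into (tangent_space x) ?D (\<chi> i. sqrt (real (d i)) * y $ i)"
    interpret D: linear ?D by (rule linear_sys_deriv)
    have T: "subspace (tangent_space x)" by (rule subspace_orthogonal_comp)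
    have bij: "inj_on ?D (tangent_space x)" "?D ` tangent_space x = UNIV"
      using False by (auto simp: tangent_singular_def bij_betw_def)
    have range: "inv_into (tangent_space x) ?D y \<in> tangent_space x" for y
      using bij(2) by (intro inv_into_into) auto
    have DL: "?D (inv_into (tangent_space x) ?D y) = y" for y
      using bij(2) by (intro f_inv_into_f) auto
    \<comment> \<open>Injectivity reduces equalities between tangent vectors to equalities of their
      images; this yields linearity of \<open>?L\<close> and the left inverse law.\<close>
    have eqI: "u = v" if "u \<in> tangent_space x" "v \<in> tangent_space x" "?D u = ?D v" for u v
      using bij(1) that by (auto dest: inj_onD)
    have L: "linear ?L"
    proof (rule linearI)
      show "?L (y + z) = ?L y + ?L z" for y z
        by (rule eqI) (auto simp: range DL D.add subspace_add [OF T] vec_eq_iff algebra_simps)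
      show "?L (c *\<^sub>R y) = c *\<^sub>R ?L y" for c y
        by (rule eqI) (auto simp: range DL D.scale subspace_scale [OF T] vec_eq_iff algebra_simps)
    qed
    have SL: "?S (?L y) = y" for y
      by (simp add: scaled_deriv_def DL vec_eq_iff d0)
    have LS: "?L (?S v) = v" if "v \<in> tangent_space x" for v
      by (rule eqI) (auto simp: range DL that scaled_deriv_def vec_eq_iff d0)
    define s where "s = onorm ?L"
    have wT: "w \<in> tangent_space x"
      using w(2) by (simp add: mem_tangent_space)
    have s: "s > 0" "norm (?S w) = 1 / s"
      unfolding s_def
      using inverse_onorm_eq_minimum [OF linear_scaled_deriv L T wT w(1) min' range SL LS] by blast+
    have "mu_norm d f x = ennreal (?N * s)"
      using False by (simp add: mu_norm_def s_def)
    \<comment> \<open>Since \<open>?N * s\<close> is positive, the reciprocal is finite and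
      \<open>enn2real\<close> loses nothing.\<close>
    then have "1 / (mu_norm d f x)\<^sup>2 = ennreal (1 / (?N * s)\<^sup>2)"
      using N s(1) divide_ennreal [of 1 "(?N * s)\<^sup>2"] by (simp add: ennreal_power)
    with N s show ?thesis
      by (simp add: power_divide power_mult_distrib)
  qed
  then show ?thesis
    by (simp add: kappa_at_def defect_def add.commute)
qed

text \<open>Inversion is antitone on nonnegative extended reals, including at 0 and infinity; this
  covers a vanishing defect.\<close>

lemma divide_left_antimono_ennreal:
  fixes a b c :: ennreal
  assumes "a \<le> b"
  shows "c / b \<le> c / a"
proof -
  have "inverse b \<le> inverse a" if "a \<le> b" for a b :: ennreal
    using that unfolding inverse_ennreal.rep_eq less_eq_ennreal.rep_eq
    by (rule ereal_inverse_antimono [OF enn2ereal_nonneg])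
  then show ?thesis
    by (simp add: divide_ennreal_def mult_left_mono assms)
qed

section \<open>Compactness of the unit tangent bundle and minima of the defect\<close>

definition unit_tangent_bundle :: "((real ^ 'n::finite option) \<times> (real ^ 'n option)) set" where
  "unit_tangent_bundle = {(x, w). norm x = 1 \<and> norm w = 1 \<and> x \<bullet> w = 0}"

text \<open>The ambient dimension is \<open>CARD('n) + 1\<close>, hence at least 2.\<close>

lemma ex_unit_tangent: "\<exists>w :: real ^ 'n::finite option. norm w = 1 \<and> x \<bullet> w = 0"
proof -
  have "2 \<le> DIM(real ^ 'n option)"
    by (simp add: Suc_le_eq)
  then obtain y where "y \<noteq> 0" "orthogonal x y"
    by (rule orthogonal_to_vector_exists)
  then show ?thesis
    by (intro exI [of _ "y /\<^sub>R norm y"]) (simp add: orthogonal_def)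
qed

lemma compact_unit_tangent_bundle: "compact (unit_tangent_bundle :: ((real ^ 'n::finite option) \<times> _) set)"
proof -
  have "closed {p :: (real ^ 'n option) \<times> (real ^ 'n option). fst p \<bullet> snd p = 0}"
    by (intro closed_Collect_eq continuous_intros)
  then have "compact ((sphere 0 1 \<times> sphere 0 1) \<inter> {p :: (real ^ 'n option) \<times> (real ^ 'n option). fst p \<bullet> snd p = 0})"
    by (intro compact_Int_closed compact_Times) simp_all
  also have "(sphere 0 1 \<times> sphere 0 1) \<inter> {p :: (real ^ 'n option) \<times> (real ^ 'n option). fst p \<bullet> snd p = 0} =
      unit_tangent_bundle"
    by (auto simp: unit_tangent_bundle_def)
  finally show ?thesis .
qed

text \<open>In coordinates the defect is a polynomial in \<open>x\<close> and \<open>w\<close>;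
  \<open>divide_inverse\<close> turns the divisions by \<open>d i\<close> into constant
  factors.\<close>

lemma continuous_on_defect: "continuous_on A (\<lambda>p. defect d f (fst p) (snd p))"
  unfolding defect_eq mpoly_eval_def mpoly_deriv_def monomial_deriv_def divide_inverse
  by (intro continuous_intros)

text \<open>The fibre over \<open>x\<close> is a closed slice of the compact bundle, and
  nonempty.\<close>

lemma ex_defect_minimum_at:
  fixes x :: "real ^ 'n::finite option"
  assumes "norm x = 1"
  obtains w where "norm w = 1" "x \<bullet> w = 0"
    "\<And>v. norm v = 1 \<Longrightarrow> x \<bullet> v = 0 \<Longrightarrow> defect d f x w \<le> defect d f x v"
proof -
  have "compact (unit_tangent_bundle \<inter> {x} \<times> (UNIV :: (real ^ 'n option) set))"
    by (intro compact_Int_closed compact_unit_tangent_bundle closed_Times) auto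
  moreover have "unit_tangent_bundle \<inter> {x} \<times> UNIV \<noteq> {}"
    using ex_unit_tangent [of x] assms by (auto simp: unit_tangent_bundle_def)
  ultimately obtain p where p: "p \<in> unit_tangent_bundle \<inter> {x} \<times> UNIV"
    and min: "\<forall>q\<in>unit_tangent_bundle \<inter> {x} \<times> UNIV. defect d f (fst p) (snd p) \<le> defect d f (fst q) (snd q)"
    using continuous_attains_inf [OF _ _ continuous_on_defect] by blast
  obtain w where w: "p = (x, w)" "norm w = 1" "x \<bullet> w = 0"
    using p by (auto simp: unit_tangent_bundle_def)
  show ?thesis
  proof (rule that [OF w(2,3)])
    fix v assume "norm v = 1" "x \<bullet> v = 0"
    with assms have "(x, v) \<in> unit_tangent_bundle \<inter> {x} \<times> UNIV"
      by (simp add: unit_tangent_bundle_def)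
    from bspec [OF min this] show "defect d f x w \<le> defect d f x v"
      by (simp add: w(1))
  qed
qed

lemma ex_defect_minimum:
  fixes f :: "'n::finite polysys"
  obtains x w where "norm x = 1" "norm w = 1" "x \<bullet> w = 0"
    "\<And>y v. norm y = 1 \<Longrightarrow> norm v = 1 \<Longrightarrow> y \<bullet> v = 0 \<Longrightarrow> defect d f x w \<le> defect d f y v"
proof -
  have "unit_tangent_bundle \<noteq> ({} :: ((real ^ 'n option) \<times> _) set)"
    using ex_unit_tangent [of "axis None 1 :: real ^ 'n option"] norm_axis_1
    by (fastforce simp: unit_tangent_bundle_def)
  then obtain p where "p \<in> unit_tangent_bundle"
    "\<forall>q\<in>unit_tangent_bundle. defect d f (fst p) (snd p) \<le> defect d f (fst q) (snd q)"
    using continuous_attains_inf [OF compact_unit_tangent_bundle _ continuous_on_defect] by blast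
  then show ?thesis
    using that [of "fst p" "snd p"] by (auto simp: unit_tangent_bundle_def)
qed

section \<open>The global minimum of the defect as common value behind condition number and
  distance\<close>

theorem theorem1p1:
  fixes d :: "'n::finite \<Rightarrow> nat" and f :: "'n polysys"
  assumes "\<And>i. d i \<ge> 1"
    and "f \<in> homogeneous_systems d"
    and "f \<noteq> 0"
  shows "(\<exists>x\<in>sphere 0 1. kappa_at d f x = kappa d f) \<and>
    kappa d f = ennreal (bw_norm d f) / bw_setdist d f (discriminant_variety d)"
proof -
  obtain x w where xw: "norm x = 1" "norm w = 1" "x \<bullet> w = 0"
    and min: "\<And>y v. norm y = 1 \<Longrightarrow> norm v = 1 \<Longrightarrow> y \<bullet> v = 0 \<Longrightarrow> defect d f x w \<le> defect d f y v"
    by (rule ex_defect_minimum [of d f]) blast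
  have kx: "kappa_at d f x = ennreal (bw_norm d f) / ennreal (sqrt (defect d f x w))"
    by (rule kappa_at_eq) (use assms xw min in auto)
  \<comment> \<open>At \<open>y\<close> the condition number is governed by the minimum over the
    fibre of \<open>y\<close>, which is at least the global minimum; so the supremum is attained at
    \<open>x\<close>.\<close>
  have "kappa_at d f y \<le> kappa_at d f x" if y: "norm y = 1" for y
  proof -
    obtain v where v: "norm v = 1" "y \<bullet> v = 0"
      and vmin: "\<And>u. norm u = 1 \<Longrightarrow> y \<bullet> u = 0 \<Longrightarrow> defect d f y v \<le> defect d f y u"
      using ex_defect_minimum_at [OF y] by blast
    have "kappa_at d f y = ennreal (bw_norm d f) / ennreal (sqrt (defect d f y v))"
      by (rule kappa_at_eq) (use assms y v vmin in auto)
    moreover have "ennreal (sqrt (defect d f x w)) \<le> ennreal (sqrt (defect d f y v))"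
      using min [OF y v] by (simp add: ennreal_leI)
    ultimately show ?thesis
      unfolding kx by (simp add: divide_left_antimono_ennreal)
  qed
  then have kappa: "kappa d f = kappa_at d f x"
    unfolding kappa_def using xw by (intro antisym SUP_least SUP_upper) auto
  \<comment> \<open>The infimum is at most the root of the minimal defect because some member of the
    discriminant variety realises it, and at least that because each member is at distance at least
    the root of some defect.\<close>
  have "bw_setdist d f (discriminant_variety d) = ennreal (sqrt (defect d f x w))"
    unfolding bw_setdist_def
  proof (rule antisym)
    show "(INF g\<in>discriminant_variety d. ennreal (bw_norm d (f - g))) \<le> ennreal (sqrt (defect d f x w))"
      using ex_multiple_zero_at_defect [OF assms(1,2) xw] by (metis INF_lower)
    show "ennreal (sqrt (defect d f x w)) \<le> (INF g\<in>discriminant_variety d. ennreal (bw_norm d (f - g)))"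
    proof (rule INF_greatest)
      fix g assume "g \<in> discriminant_variety d"
      then obtain y where g: "g \<in> homogeneous_systems d" and y: "norm y = 1" "multiple_zero g y"
        by (auto simp: discriminant_variety_def)
      obtain v where v: "norm v = 1" "y \<bullet> v = 0" "sqrt (defect d f y v) \<le> bw_norm d (f - g)"
        using bw_norm_diff_multiple_zero_ge [OF assms(1,2) g y] by blast
      have "sqrt (defect d f x w) \<le> sqrt (defect d f y v)"
        using min [OF y(1) v(1,2)] by simp
      with v(3) show "ennreal (sqrt (defect d f x w)) \<le> ennreal (bw_norm d (f - g))"
        by (intro ennreal_leI) linarith
    qed
  qed
  with kx kappa xw show ?thesis
    by auto
qed
end
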